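(* Let $S$ be a right-uniformizable topological semigroup. Then each continuous left unit operation $\lambda:S\to S$ on $S$ is dicontinuous. Consequently, each right-uniformizable topological left unosemigroup $(S,\lambda)$ (i.e. one whose underlying topological semigroup $S$ is right-uniformizable) is a ditopological left unosemigroup.
   Context: A topological semigroup is a non-empty topological space $S$ endowed with a continuous associative binary operation $\cdot:S\times S\to S$. A left unit operation on $S$ is a map $\lambda:S\to S$ with $\lambda(x)\cdot x=x$ for all $x\in S$. A topological left unosemigroup $(S,\lambda)$ is a topological semigroup $S$ with a continuous left unit operation $\lambda$. A topological semigroup $S$ is right-uniformizable if the topology of $S$ is generated by a uniformity $\mathcal U$ on $S$ such that for every entourage $U\in\mathcal U$ there is an entourage $V\in\mathcal U$ with $B(x,V)\cdot y\subset B(xy,U)$ for all $x,y\in S$, where $B(x,V)=\{z\in S:(x,z)\in V\}$. For $A,B\subset S$ put $A\leftthreetimes B=\{x\in S: ax\in B \text{ for some } a\in A\}$. A continuous left unit operation $\lambda:S\to S$ is dicontinuous at $x\in S$ if for every neighborhood $O_x\subset S$ of $x$ there are a neighborhood $U_x\subset S$ of $x$ in $S$ and a neighborhood $W_{\lambda(x)}\subset\lambda(S)$ of $\lambda(x)$ in the subspace $\lambda(S)$ such that $(W_{\lambda(x)}\leftthreetimes U_x)\cap\lambda^{-1}(W_{\lambda(x)})\subset O_x$. It is dicontinuous if it is dicontinuous at each point of $S$. A ditopological left unosemigroup is a topological semigroup endowed with a dicontinuous (continuous) left unit operation. *)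

theory Defs
  imports "HOL-Analysis.Analysis"
begin

text \<open>
  A topological semigroup is a type of class \<^class>\<open>topological_semigroup_mult\<close>. The class
  \<^class>\<open>uniform_space\<close> would fix one uniformity per type; the uniformity below is
  instead bound existentially, through the predicate of that class. It is the filter of its
  entourages, and the ball \<open>B(x,V) = {z. (x,z) \<in> V}\<close> is \<open>V `` {x}\<close>.
\<close>

definition right_uniformizable :: "'a::topological_semigroup_mult itself \<Rightarrow> bool" where
  "right_uniformizable TYPE('a) \<longleftrightarrow>
     (\<exists>\<U> :: ('a \<times> 'a) filter. class.uniform_space open \<U> \<and>
       (\<forall>U. (\<forall>\<^sub>F p in \<U>. p \<in> U) \<longrightarrow>
         (\<exists>V. (\<forall>\<^sub>F p in \<U>. p \<in> V) \<and>
           (\<forall>x y. (\<lambda>z. z * y) ` (V `` {x}) \<subseteq> U `` {x * y}))))"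

definition left_unit_operation :: "('a::semigroup_mult \<Rightarrow> 'a) \<Rightarrow> bool" where
  "left_unit_operation l \<longleftrightarrow> (\<forall>x. l x * x = x)"

definition topological_left_unosemigroup :: "('a::topological_semigroup_mult \<Rightarrow> 'a) \<Rightarrow> bool" where
  "topological_left_unosemigroup l \<longleftrightarrow> left_unit_operation l \<and> continuous_on UNIV l"

definition left_quotient :: "'a::semigroup_mult set \<Rightarrow> 'a set \<Rightarrow> 'a set" (infixl "\<leftthreetimes>" 70) where
  "A \<leftthreetimes> B = {x. \<exists>a\<in>A. a * x \<in> B}"

text \<open>
  Neighborhoods are taken to be open. The condition is unaffected by this choice, since the left-hand
  side of the inclusion is monotone in \<open>U\<close> and \<open>W\<close>.
\<close>

definition dicontinuous_at :: "('a::topological_semigroup_mult \<Rightarrow> 'a) \<Rightarrow> 'a \<Rightarrow> bool" where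
  "dicontinuous_at l x \<longleftrightarrow>
     (\<forall>O'. open O' \<and> x \<in> O' \<longrightarrow>
       (\<exists>U W. open U \<and> x \<in> U \<and>
         openin (top_of_set (range l)) W \<and> l x \<in> W \<and>
         (W \<leftthreetimes> U) \<inter> l -` W \<subseteq> O'))"

definition dicontinuous :: "('a::topological_semigroup_mult \<Rightarrow> 'a) \<Rightarrow> bool" where
  "dicontinuous l \<longleftrightarrow> (\<forall>x. dicontinuous_at l x)"

definition ditopological_left_unosemigroup :: "('a::topological_semigroup_mult \<Rightarrow> 'a) \<Rightarrow> bool" where
  "ditopological_left_unosemigroup l \<longleftrightarrow>
     left_unit_operation l \<and> continuous_on UNIV l \<and> dicontinuous l"

end

theory Submission
  imports Defs
begin

text \<open>
  If \<open>a\<close> and \<open>l y\<close> are both close to \<open>l x\<close>, they are close to each other, so by right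
  uniformity \<open>a * y\<close> is close to \<open>l y * y = y\<close>, uniformly in \<open>y\<close>. Hence if \<open>a * y\<close> is
  close to \<open>x\<close>, so is \<open>y\<close>.
\<close>

text \<open>In a uniform topology the ball of any entourage about \<open>x\<close> is a neighborhood
  of \<open>x\<close>, so it contains an open \<open>A\<close> around \<open>x\<close>. Since \<U>
  is a bound variable, class facts about uniformities are reached by interpreting the
  locale.\<close>

lemma uniform_space_ball_nhd:
  fixes \<U> :: "('a::topological_space \<times> 'a) filter"
  assumes "class.uniform_space open \<U>" "eventually P \<U>"
  obtains A where "open A" "x \<in> A" "\<And>y. y \<in> A \<Longrightarrow> P (x, y)"
proof -
  interpret uniform_space "open :: 'a set \<Rightarrow> bool" \<U>
    by fact
  \<comment> \<open>The interpretation supplies its own neighborhood filter, built from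
    \<open>open\<close>; unfolding both definitions identifies it with the \<open>nhds\<close> of
    the type class.\<close>
  have "topological_space.nhds open x = nhds x"
    by (simp add: topological_space.nhds_def[OF topological_space_axioms] nhds_def)
  moreover have "\<forall>\<^sub>F (x', y) in \<U>. x' = x \<longrightarrow> P (x, y)"
    using assms(2) by (rule eventually_mono) auto
  ultimately have "\<forall>\<^sub>F y in nhds x. P (x, y)"
    using local.eventually_nhds_uniformity[of "\<lambda>y. P (x, y)" x] by simp
  then show thesis
    using that by (auto simp: eventually_nhds)
qed

text \<open>Choose \<open>D\<close> whose composite with itself lies in \<open>P\<close>, and let
  \<open>A\<close> lie in the ball about \<open>x\<close> of the symmetric part of \<open>D\<close>.
  Any \<open>y\<close> and \<open>z\<close> in \<open>A\<close> are then linked through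
  \<open>x\<close>: symmetry gives \<open>D (y, x)\<close>, and \<open>D (x, z)\<close> completes
  the chain.\<close>

lemma uniform_space_square_nhd:
  fixes \<U> :: "('a::topological_space \<times> 'a) filter"
  assumes \<U>: "class.uniform_space open \<U>" and P: "eventually P \<U>"
  obtains A where "open A" "x \<in> A" "\<And>y z. y \<in> A \<Longrightarrow> z \<in> A \<Longrightarrow> P (y, z)"
proof -
  interpret uniform_space "open :: 'a set \<Rightarrow> bool" \<U>
    by fact
  obtain D where D: "eventually D \<U>" "\<And>x y z. D (x, y) \<Longrightarrow> D (y, z) \<Longrightarrow> P (x, z)"
    using uniformity_trans[OF P] by blast
  have "\<forall>\<^sub>F p in \<U>. D (snd p, fst p)"
    using uniformity_sym[OF D(1)] by (simp add: case_prod_unfold)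
  with D(1) have "\<forall>\<^sub>F p in \<U>. D p \<and> D (snd p, fst p)"
    by (rule eventually_conj)
  then obtain A where A: "open A" "x \<in> A"
    and "\<And>y. y \<in> A \<Longrightarrow> D (x, y) \<and> D (snd (x, y), fst (x, y))"
    using uniform_space_ball_nhd[OF \<U>, of "\<lambda>p. D p \<and> D (snd p, fst p)" x] by metis
  then have "P (y, z)" if "y \<in> A" "z \<in> A" for y z
    using that D(2)[of y x z] by simp
  with A show thesis
    by (rule that)
qed

lemma right_uniformizable_imp_dicontinuous:
  fixes l :: "'a::topological_semigroup_mult \<Rightarrow> 'a"
  assumes S: "right_uniformizable TYPE('a)"
    and l: "left_unit_operation l"
  shows "dicontinuous l"
  unfolding dicontinuous_def dicontinuous_at_def
proof (intro allI impI)
  fix x :: 'a and N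
  assume N: "open N \<and> x \<in> N"
  obtain \<U> :: "('a \<times> 'a) filter" where \<U>: "class.uniform_space open \<U>"
    and right: "\<And>U. (\<forall>\<^sub>F p in \<U>. p \<in> U) \<Longrightarrow>
      \<exists>V. (\<forall>\<^sub>F p in \<U>. p \<in> V) \<and> (\<forall>x y. (\<lambda>z. z * y) ` (V `` {x}) \<subseteq> U `` {x * y})"
    using S unfolding right_uniformizable_def by blast
  interpret uniform_space "open :: 'a set \<Rightarrow> bool" \<U>
    by fact
  have "\<forall>\<^sub>F (x', y) in \<U>. x' = x \<longrightarrow> y \<in> N"
    using N open_uniformity[of N] by simp
  \<comment> \<open>\<open>D\<close> is a half-size entourage, since the route into \<open>N\<close>
    has two legs: from \<open>x\<close> to \<open>a * y\<close>, then from \<open>a * y\<close> to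
    \<open>y\<close>.\<close>
  then obtain D where D: "eventually D \<U>"
    and "\<And>x' y z. D (x', y) \<Longrightarrow> D (y, z) \<Longrightarrow> case (x', z) of (x', z) \<Rightarrow> x' = x \<longrightarrow> z \<in> N"
    by (rule uniformity_transE) blast
  then have D_trans: "\<And>y z. D (x, y) \<Longrightarrow> D (y, z) \<Longrightarrow> z \<in> N"
    by simp
  from D have "\<forall>\<^sub>F p in \<U>. p \<in> Collect D"
    by simp
  from right[OF this] obtain V where V: "\<forall>\<^sub>F p in \<U>. p \<in> V"
    and "\<forall>a y. (\<lambda>z. z * y) ` (V `` {a}) \<subseteq> Collect D `` {a * y}"
    by blast
  then have V_right: "\<And>a b y. (a, b) \<in> V \<Longrightarrow> D (a * y, b * y)"
    by blast
  obtain U where U: "open U" "x \<in> U" "\<And>y. y \<in> U \<Longrightarrow> D (x, y)"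
    using uniform_space_ball_nhd[OF \<U> D] by blast
  \<comment> \<open>A ball about \<open>l x\<close> alone would compare points only with
    \<open>l x\<close>; here \<open>a\<close> and \<open>l y\<close> must be compared with each
    other.\<close>
  obtain A where A: "open A" "l x \<in> A" "\<And>a b. a \<in> A \<Longrightarrow> b \<in> A \<Longrightarrow> (a, b) \<in> V"
    using uniform_space_square_nhd[OF \<U> V] by blast
  define W where "W = range l \<inter> A"
  have "(W \<leftthreetimes> U) \<inter> l -` W \<subseteq> N"
  proof
    fix y assume "y \<in> (W \<leftthreetimes> U) \<inter> l -` W"
    then obtain a where a: "a \<in> A" "a * y \<in> U" "l y \<in> A"
      by (auto simp: left_quotient_def W_def)
    \<comment> \<open>Membership in the left quotient puts \<open>a\<close> in \<open>A\<close>, and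
      membership in the preimage puts \<open>l y\<close> there, so \<open>(a, l y)\<close> is in
      \<open>V\<close>. Right multiplication by \<open>y\<close> carries this pair into
      \<open>D\<close>.\<close>
    have "D (a * y, l y * y)"
      using A(3) V_right a by blast
    then have "D (a * y, y)"
      using l by (simp add: left_unit_operation_def)
    with U(3) a D_trans show "y \<in> N"
      by blast
  qed
  moreover have "openin (top_of_set (range l)) W" "l x \<in> W"
    using A by (auto simp: W_def openin_open)
  ultimately show "\<exists>U W. open U \<and> x \<in> U \<and> openin (top_of_set (range l)) W \<and> l x \<in> W \<and>
      (W \<leftthreetimes> U) \<inter> l -` W \<subseteq> N"
    using U(1,2) by (intro exI[of _ U] exI[of _ W]) simp
qed

theorem theorem1:
  assumes "right_uniformizable TYPE('a::topological_semigroup_mult)"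
  shows "(\<forall>l :: 'a \<Rightarrow> 'a. left_unit_operation l \<and> continuous_on UNIV l \<longrightarrow> dicontinuous l) \<and>
         (\<forall>l :: 'a \<Rightarrow> 'a. topological_left_unosemigroup l \<longrightarrow> ditopological_left_unosemigroup l)"
  using right_uniformizable_imp_dicontinuous[OF assms]
  by (simp add: topological_left_unosemigroup_def ditopological_left_unosemigroup_def)

end
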